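(* Let $R=k[x_1,\ldots,x_d]$ be a polynomial ring over a field $k$, let $r\geq 2$ be an integer, and let $I$ be a monomial ideal of $R$ minimally generated by monomials $x^{v_1},\ldots,x^{v_q}$ all of degree $r$. Then $\overline{I^{b}}=I\,\overline{I^{b-1}}$ for all integers $b\geq d-\lfloor d/r\rfloor+1$.
   Context: For $a=(a_1,\ldots,a_d)\in\mathbb{N}^d$, $x^a=x_1^{a_1}\cdots x_d^{a_d}$ and $\deg(x^a)=a_1+\cdots+a_d$. For an ideal $J$ of $R$, $\overline{J}$ denotes its integral closure in $R$; by convention $I^0=R$. *)

theory Defs
  imports Complex_Main "HOL-Library.Poly_Mapping" "HOL-Library.Cardinality"
begin

text \<open>
  The polynomial ring $k[x_1,\ldots,x_d]$ is the monoid algebra of the exponent monoid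
  $\mathbb{N}^d$: with a finite index type \<open>'n\<close> for the variables, \<open>d = CARD('n)\<close>,
  exponent vectors have type \<open>'n \<Rightarrow>\<^sub>0 nat\<close>.
\<close>

type_synonym ('n, 'k) mpoly = "('n \<Rightarrow>\<^sub>0 nat) \<Rightarrow>\<^sub>0 'k"

definition monomial :: "('n::finite \<Rightarrow>\<^sub>0 nat) \<Rightarrow> ('n, 'k::field) mpoly" where
  "monomial a = Poly_Mapping.single a 1"

definition monomial_degree :: "('n::finite \<Rightarrow>\<^sub>0 nat) \<Rightarrow> nat" where
  "monomial_degree a = (\<Sum>i\<in>UNIV. Poly_Mapping.lookup a i)"

text \<open>Ideals of a commutative ring are its submodules as a module over itself.\<close>

lemma module_times: "module ((*) :: 'a::comm_ring_1 \<Rightarrow> 'a \<Rightarrow> 'a)"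
  by unfold_locales (simp_all add: algebra_simps)

definition ideal_generated :: "'a::comm_ring_1 set \<Rightarrow> 'a set" where
  "ideal_generated S = module.span (*) S"

definition ideal_mult :: "'a::comm_ring_1 set \<Rightarrow> 'a set \<Rightarrow> 'a set" where
  "ideal_mult I J = ideal_generated {x * y | x y. x \<in> I \<and> y \<in> J}"

primrec ideal_power :: "'a::comm_ring_1 set \<Rightarrow> nat \<Rightarrow> 'a set" where
  "ideal_power I 0 = UNIV"
| "ideal_power I (Suc n) = ideal_mult I (ideal_power I n)"

text \<open>
  The integral closure of an ideal \<open>J\<close> in the ambient ring: all \<open>x\<close> satisfying an equation
  $x^n + c_1 x^{n-1} + \cdots + c_n = 0$ with $n \ge 1$ and $c_i \in J^i$.
\<close>

definition integral_closure :: "'a::comm_ring_1 set \<Rightarrow> 'a set" where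
  "integral_closure J =
    {x. \<exists>n\<ge>1. \<exists>c :: nat \<Rightarrow> 'a. (\<forall>i\<in>{1..n}. c i \<in> ideal_power J i) \<and>
        x ^ n + (\<Sum>i=1..n. c i * x ^ (n - i)) = 0}"

text \<open>
  The generators are an indexed family, so minimality (no proper subfamily generates)
  also excludes repetitions in the list of generators.
\<close>

definition minimally_generated_by :: "'a::comm_ring_1 set \<Rightarrow> 'i set \<Rightarrow> ('i \<Rightarrow> 'a) \<Rightarrow> bool" where
  "minimally_generated_by I A g \<longleftrightarrow>
    I = ideal_generated (g ` A) \<and> (\<forall>B. B \<subset> A \<longrightarrow> I \<noteq> ideal_generated (g ` B))"

end

theory Submission
  imports Defs "HOL-Analysis.Function_Topology"
begin

text \<open>
  Let \<open>V\<close> be the set of exponent vectors of the generators, \<open>d\<close> the number of variables, and \<open>newton V c\<close> the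
  set of lattice points that dominate some \<open>\<Sum>v\<in>V. \<theta> v * v\<close> with nonnegative weights \<open>\<theta>\<close> of total \<open>c\<close>,
  that is, the lattice points of the \<open>c\<close>-fold Newton polyhedron. The integral closure of \<open>I^b\<close> consists of the
  polynomials supported in \<open>newton V b\<close> (\<open>integral_closure_monomial_ideal_power\<close>). The theorem therefore asks
  whether every \<open>a \<in> newton V b\<close> is the sum of some \<open>v \<in> V\<close> and a vector of \<open>newton V (b - 1)\<close>.

  If some weight is at least one, lowering it by one does this. So the point is that
  for \<open>b \<ge> d - d div r + 1\<close> the weights can be chosen not all below one (\<open>newton_remove_vertex\<close>). By a
  Caratheodory argument (\<open>sparse_fractional_packing\<close>) the weights may be taken sparse, where sparsity
  is measured against the numbers of nonzero and of fractional coordinates of the weighted sum \<open>w\<close>.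
  If all weights are below one, reflecting \<open>w\<close> to \<open>\<Sum>(1 - \<theta> v) * v\<close> yields a vector that is positive on
  all nonzero coordinates of \<open>w\<close>. Rounding \<open>w\<close> down makes the reflected vector integral, hence at least one
  there, and comparing degrees gives \<open>b \<le> d - d div r\<close> (\<open>sparse_packing_sum_bound\<close>).

  The description of the integral closure uses the same splitting lemma. That an integral
  polynomial is supported in the Newton polyhedron is seen from a suitably extremal exponent
  of its support (\<open>keys_in_newton_if_integral\<close>). Conversely, if \<open>f\<close> is supported in \<open>newton V b\<close>, then
  multiplication by \<open>f\<close> maps the finitely generated ideal \<open>M\<close> of polynomials supported in \<open>newton V m\<close>, for
  large \<open>m\<close>, into \<open>I^b M\<close>, because \<open>b\<close> generators can be split off one after the other. Elimination in the
  resulting linear system for the generators of \<open>M\<close> gives an integral equation for \<open>f\<close>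
  (\<open>integral_dependence_by_elimination\<close>).
\<close>

section \<open>Fractional packings and the Newton polyhedron\<close>

abbreviation coord :: "('n \<Rightarrow>\<^sub>0 nat) \<Rightarrow> 'n \<Rightarrow> nat" where
  "coord \<equiv> Poly_Mapping.lookup"

definition fractional_packing ::
    "('n::finite \<Rightarrow>\<^sub>0 nat) set \<Rightarrow> real \<Rightarrow> ('n \<Rightarrow>\<^sub>0 nat) \<Rightarrow> (('n \<Rightarrow>\<^sub>0 nat) \<Rightarrow> real) \<Rightarrow> bool" where
  "fractional_packing V c a \<theta> \<longleftrightarrow>
    (\<forall>v\<in>V. 0 \<le> \<theta> v) \<and> sum \<theta> V = c \<and> (\<forall>j. (\<Sum>v\<in>V. \<theta> v * real (coord v j)) \<le> real (coord a j))"

text \<open>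
  For nonempty \<open>V\<close>, the lattice points of the Newton polyhedron dilated by \<open>c\<close>: \<open>c\<close> times the
  convex hull of \<open>V\<close>, plus the nonnegative orthant. The weights stay explicit because the proofs below
  change them one by one.
\<close>

definition newton :: "('n::finite \<Rightarrow>\<^sub>0 nat) set \<Rightarrow> real \<Rightarrow> ('n \<Rightarrow>\<^sub>0 nat) set" where
  "newton V c = {a. \<exists>\<theta>. fractional_packing V c a \<theta>}"

lemma newton_iff: "a \<in> newton V c \<longleftrightarrow> (\<exists>\<theta>. fractional_packing V c a \<theta>)"
  by (simp add: newton_def)

lemma fractional_packing_degree:
  assumes "\<And>v. v \<in> V \<Longrightarrow> monomial_degree v = r"
  shows "(\<Sum>j\<in>UNIV. \<Sum>v\<in>V. \<theta> v * real (coord v j)) = real r * sum \<theta> V"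
proof -
  have "(\<Sum>j\<in>UNIV. \<Sum>v\<in>V. \<theta> v * real (coord v j)) = (\<Sum>v\<in>V. \<theta> v * real (\<Sum>j\<in>UNIV. coord v j))"
    by (subst sum.swap) (simp add: sum_distrib_left)
  also have "\<dots> = (\<Sum>v\<in>V. \<theta> v * real r)"
    using assms unfolding monomial_degree_def by (intro sum.cong) auto
  finally show ?thesis by (simp add: sum_distrib_left mult.commute)
qed

lemma newton_zero: "a \<in> newton V 0"
  by (auto simp: newton_iff fractional_packing_def intro: exI[of _ "\<lambda>_. 0"])

lemma newton_nonneg: "a \<in> newton V c \<Longrightarrow> 0 \<le> c"
  by (auto simp: newton_iff fractional_packing_def intro: sum_nonneg)

lemma newton_add:
  assumes "a \<in> newton V c" "a' \<in> newton V c'"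
  shows "a + a' \<in> newton V (c + c')"
proof -
  obtain \<theta> \<theta>' where "fractional_packing V c a \<theta>" "fractional_packing V c' a' \<theta>'"
    using assms by (auto simp: newton_iff)
  then have "fractional_packing V (c + c') (a + a') (\<lambda>v. \<theta> v + \<theta>' v)"
    by (auto simp: fractional_packing_def sum.distrib lookup_add distrib_right add_mono)
  then show ?thesis by (auto simp: newton_iff)
qed

lemma newton_mono:
  assumes "a \<in> newton V c" "0 \<le> c'" "c' \<le> c"
  shows "a \<in> newton V c'"
proof (cases "c' = 0")
  case True
  then show ?thesis by (simp add: newton_zero)
next
  case False
  define t where "t = c' / c"
  have t: "0 \<le> t" "t \<le> 1" "t * c = c'" using assms False by (auto simp: t_def)
  obtain \<theta> where \<theta>: "fractional_packing V c a \<theta>" using assms by (auto simp: newton_iff)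
  have "(\<Sum>v\<in>V. t * \<theta> v * real (coord v j)) \<le> real (coord a j)" for j
  proof -
    have "(\<Sum>v\<in>V. t * \<theta> v * real (coord v j)) = t * (\<Sum>v\<in>V. \<theta> v * real (coord v j))"
      by (simp add: sum_distrib_left mult.assoc)
    also have "\<dots> \<le> (\<Sum>v\<in>V. \<theta> v * real (coord v j))"
      using t \<theta> by (intro mult_left_le_one_le sum_nonneg) (auto simp: fractional_packing_def)
    also have "\<dots> \<le> real (coord a j)" using \<theta> by (simp add: fractional_packing_def)
    finally show ?thesis .
  qed
  moreover have "(\<Sum>v\<in>V. t * \<theta> v) = c'"
    using \<theta> t by (simp add: fractional_packing_def flip: sum_distrib_left)
  ultimately have "fractional_packing V c' a (\<lambda>v. t * \<theta> v)"
    using \<theta> t by (simp add: fractional_packing_def)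
  then show ?thesis by (auto simp: newton_iff)
qed

lemma newton_vertex: "finite V \<Longrightarrow> v \<in> V \<Longrightarrow> v \<in> newton V 1"
  by (auto simp: newton_iff fractional_packing_def if_distrib[of "\<lambda>x. x * _"] cong: if_cong
      intro!: exI[of _ "\<lambda>x. if x = v then 1 else 0"])

lemma newton_degree_bound:
  assumes "\<And>v. v \<in> V \<Longrightarrow> monomial_degree v = r" "a \<in> newton V c"
  shows "real r * c \<le> real (monomial_degree a)"
proof -
  obtain \<theta> where "fractional_packing V c a \<theta>" using assms by (auto simp: newton_iff)
  then have "(\<Sum>j\<in>UNIV. \<Sum>v\<in>V. \<theta> v * real (coord v j)) \<le> (\<Sum>j\<in>UNIV. real (coord a j))"
      "sum \<theta> V = c"
    by (auto simp: fractional_packing_def intro!: sum_mono)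
  then show ?thesis
    using fractional_packing_degree[of V r \<theta>] assms by (simp add: monomial_degree_def)
qed

lemma newton_divide:
  assumes "(\<Sum>i<n. a) \<in> newton V c" "n \<ge> 1"
  shows "a \<in> newton V (c / real n)"
proof -
  obtain \<theta> where \<theta>: "fractional_packing V c (\<Sum>i<n. a) \<theta>" using assms by (auto simp: newton_iff)
  have "(\<Sum>v\<in>V. \<theta> v / real n * real (coord v j)) \<le> real (coord a j)" for j
  proof -
    have "(\<Sum>v\<in>V. \<theta> v * real (coord v j)) \<le> real n * real (coord a j)"
      using \<theta> by (simp add: fractional_packing_def lookup_sum)
    then show ?thesis using assms(2) by (simp add: sum_divide_distrib[symmetric] field_simps)
  qed
  then have "fractional_packing V (c / real n) a (\<lambda>v. \<theta> v / real n)"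
    using \<theta> by (simp add: fractional_packing_def flip: sum_divide_distrib)
  then show ?thesis by (auto simp: newton_iff)
qed

section \<open>Splitting off one generator\<close>

text \<open>
  Gaussian elimination of one equation against one unknown \<open>p\<close>, whose value is recovered at the end.
\<close>

lemma underdetermined_system_nontrivial_solution:
  fixes M :: "'a \<Rightarrow> 'e \<Rightarrow> real"
  assumes "finite E" "finite S" "card E < card S"
  shows "\<exists>\<alpha>. (\<exists>i\<in>S. \<alpha> i \<noteq> 0) \<and> (\<forall>e\<in>E. (\<Sum>i\<in>S. \<alpha> i * M i e) = 0)"
  using assms
proof (induction E arbitrary: S M rule: finite_induct)
  case empty
  then obtain i where "i \<in> S" by fastforce
  then show ?case by (intro exI[of _ "\<lambda>_. 1"]) auto
next
  case (insert e E)
  show ?case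
  proof (cases "\<forall>i\<in>S. M i e = 0")
    case True
    moreover obtain \<alpha> where "\<exists>i\<in>S. \<alpha> i \<noteq> 0" "\<forall>e\<in>E. (\<Sum>i\<in>S. \<alpha> i * M i e) = 0"
      using insert.IH[of S M] insert.prems insert.hyps by auto
    ultimately show ?thesis by (intro exI[of _ \<alpha>]) auto
  next
    case False
    then obtain p where p: "p \<in> S" "M p e \<noteq> 0" by auto
    define M' where "M' i k = M i k - M i e / M p e * M p k" for i k
    have "card E < card (S - {p})"
      using insert p by (simp add: card_Diff_singleton)
    then obtain \<alpha> where \<alpha>: "\<exists>i\<in>S-{p}. \<alpha> i \<noteq> 0" "\<forall>k\<in>E. (\<Sum>i\<in>S-{p}. \<alpha> i * M' i k) = 0"
      using insert.IH[of "S - {p}" M'] insert.prems by auto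
    define \<beta> where "\<beta> i = (if i = p then - (\<Sum>i\<in>S-{p}. \<alpha> i * M i e / M p e) else \<alpha> i)" for i
    have \<beta>: "(\<Sum>i\<in>S. \<beta> i * M i k) = (\<Sum>i\<in>S-{p}. \<alpha> i * M' i k)" for k
    proof -
      have "(\<Sum>i\<in>S. \<beta> i * M i k) = \<beta> p * M p k + (\<Sum>i\<in>S-{p}. \<beta> i * M i k)"
        using p insert.prems by (subst sum.remove[of _ p]) auto
      also have "(\<Sum>i\<in>S-{p}. \<beta> i * M i k) = (\<Sum>i\<in>S-{p}. \<alpha> i * M i k)"
        by (intro sum.cong) (auto simp: \<beta>_def)
      also have "\<beta> p * M p k = (\<Sum>i\<in>S-{p}. - (\<alpha> i * M i e / M p e * M p k))"
        by (simp add: \<beta>_def sum_distrib_right sum_negf)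
      finally show ?thesis
        by (simp add: M'_def sum.distrib[symmetric] algebra_simps)
    qed
    have "(\<Sum>i\<in>S-{p}. \<alpha> i * M' i e) = 0"
      using p by (simp add: M'_def)
    moreover have "\<exists>i\<in>S. \<beta> i \<noteq> 0"
      using \<alpha>(1) by (auto simp: \<beta>_def)
    ultimately show ?thesis
      using \<alpha>(2) by (intro exI[of _ \<beta>]) (auto simp: \<beta>)
  qed
qed

text \<open>
  Some quantity decreases along the ray, so the first zero occurs at the least of the finitely many
  ratios \<open>p k / - c k\<close>.
\<close>

lemma first_constraint_hit:
  fixes p c :: "'a \<Rightarrow> real"
  assumes "finite F" "\<And>k. k \<in> F \<Longrightarrow> 0 < p k" "\<exists>k\<in>F. c k < 0"
  shows "\<exists>\<epsilon>>0. (\<forall>k\<in>F. 0 \<le> p k + \<epsilon> * c k) \<and> (\<exists>k\<in>F. p k + \<epsilon> * c k = 0)"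
proof -
  define N where "N = {k\<in>F. c k < 0}"
  have N: "finite N" "N \<noteq> {}" using assms by (auto simp: N_def)
  define \<epsilon> where "\<epsilon> = Min ((\<lambda>k. p k / - c k) ` N)"
  have "\<epsilon> \<in> (\<lambda>k. p k / - c k) ` N" unfolding \<epsilon>_def using N by (intro Min_in) auto
  then obtain k where k: "k \<in> N" "\<epsilon> = p k / - c k" by auto
  have "0 < p k" "c k < 0" using k assms by (auto simp: N_def)
  then have pos: "\<epsilon> > 0" using k by (simp add: divide_pos_neg)
  have "0 \<le> p i + \<epsilon> * c i" if "i \<in> F" for i
  proof (cases "i \<in> N")
    case True
    then have "\<epsilon> \<le> p i / - c i" unfolding \<epsilon>_def using N by (intro Min_le) auto
    moreover have "c i < 0" using True by (simp add: N_def)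
    ultimately show ?thesis by (simp add: field_simps)
  next
    case False
    then have "c i \<ge> 0" using that by (simp add: N_def)
    then show ?thesis using pos assms(2)[OF that] by (simp add: less_imp_le)
  qed
  moreover have "p k + \<epsilon> * c k = 0" using k by (auto simp: N_def field_simps)
  ultimately show ?thesis using pos k(1) by (auto simp: N_def)
qed

text \<open>
  The dimension count that a Caratheodory reduction leaves. Below, \<open>s\<close> is the number of nonzero
  weights, and \<open>m\<close> and \<open>t\<close> are the numbers of nonzero and of fractional coordinates of the weighted sum.
\<close>

definition sparse :: "('n::finite \<Rightarrow>\<^sub>0 nat) set \<Rightarrow> (('n \<Rightarrow>\<^sub>0 nat) \<Rightarrow> real) \<Rightarrow> bool" where
  "sparse V \<theta> \<longleftrightarrow>
    card {v\<in>V. \<theta> v \<noteq> 0} + card {j. (\<Sum>v\<in>V. \<theta> v * real (coord v j)) \<notin> \<int>}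
        \<le> card {j. (\<Sum>v\<in>V. \<theta> v * real (coord v j)) \<noteq> 0}
          + (if {j. (\<Sum>v\<in>V. \<theta> v * real (coord v j)) \<notin> \<int>} = {} then 0 else 1)"

text \<open>
  The idea of Caratheodory's theorem. Keep the integral coordinates of the sum \<open>w\<close> fixed: this
  gives at most \<open>m - t\<close> homogeneous equations on a change of the \<open>s\<close> nonzero weights, and fixing
  the total weight gives one more. With too many weights the system has a nonzero solution, and moving
  along it until a weight vanishes or a fractional coordinate becomes integral lowers \<open>s + t\<close>.
  When \<open>t = 0\<close>, the last equation follows from the others because all exponents have the same
  degree, so the bound improves by one. The vector \<open>a\<close> still dominates because a moving
  coordinate stays below its rounding up, and \<open>a\<close> is integral.
\<close>

lemma sparse_fractional_packing:
  fixes V :: "('n::finite \<Rightarrow>\<^sub>0 nat) set" and a :: "'n \<Rightarrow>\<^sub>0 nat"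
  assumes fin: "finite V" and deg: "\<And>v. v \<in> V \<Longrightarrow> monomial_degree v = r" and r: "r \<ge> 1"
    and a: "a \<in> newton V c"
  obtains \<theta> where "fractional_packing V c a \<theta>"
    and "sparse V \<theta>"
proof -
  define w where "w \<theta> j = (\<Sum>v\<in>V. \<theta> v * real (coord v j))" for \<theta> j
  define S where "S \<theta> = {v\<in>V. \<theta> v \<noteq> 0}" for \<theta> :: "('n \<Rightarrow>\<^sub>0 nat) \<Rightarrow> real"
  define T where "T \<theta> = {j. w \<theta> j \<notin> \<int>}" for \<theta>
  define M where "M \<theta> = {j. w \<theta> j \<noteq> 0}" for \<theta>
  obtain \<theta> where \<theta>: "fractional_packing V c a \<theta>"
    and least: "\<And>\<theta>'. fractional_packing V c a \<theta>' \<Longrightarrow>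
      card (S \<theta>) + card (T \<theta>) \<le> card (S \<theta>') + card (T \<theta>')"
    using a ex_has_least_nat[of "fractional_packing V c a" _ "\<lambda>\<theta>. card (S \<theta>) + card (T \<theta>)"]
    unfolding newton_iff by blast
  have nonneg: "\<And>v. v \<in> V \<Longrightarrow> 0 \<le> \<theta> v" and sum\<theta>: "sum \<theta> V = c"
    and le: "\<And>j. w \<theta> j \<le> coord a j"
    using \<theta> by (auto simp: fractional_packing_def w_def)
  have finS: "finite (S \<theta>)" and SV: "S \<theta> \<subseteq> V" using fin by (auto simp: S_def)
  have "card (S \<theta>) + card (T \<theta>) \<le> card (M \<theta>) + (if T \<theta> = {} then 0 else 1)"
  proof (rule ccontr)
    assume many: "\<not> ?thesis"
    have TM: "T \<theta> \<subseteq> M \<theta>" by (auto simp: T_def M_def)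
    have outside: "coord v j = 0" if "v \<in> S \<theta>" "j \<notin> M \<theta>" for v j
    proof -
      have "w \<theta> j = 0" using that by (simp add: M_def)
      then have "\<theta> v * real (coord v j) = 0"
        unfolding w_def using fin nonneg that by (subst (asm) sum_nonneg_eq_0_iff) (auto simp: S_def)
      then show ?thesis using that by (auto simp: S_def)
    qed
    \<comment> \<open>The index \<open>None\<close> stands for the equation that fixes the total weight.\<close>
    define E where "E = Some ` (M \<theta> - T \<theta>) \<union> (if T \<theta> = {} then {} else {None})"
    define A where "A v e = (case e of Some j \<Rightarrow> real (coord v j) | None \<Rightarrow> 1)"
      for v :: "'n \<Rightarrow>\<^sub>0 nat" and e
    have "card (M \<theta> - T \<theta>) = card (M \<theta>) - card (T \<theta>)" "card (T \<theta>) \<le> card (M \<theta>)"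
      using TM by (auto intro!: card_Diff_subset card_mono finite_subset[OF _ finite])
    moreover have "card E \<le> card (M \<theta> - T \<theta>) + (if T \<theta> = {} then 0 else 1)"
      unfolding E_def by (intro card_Un_le[THEN order_trans]) (auto simp: card_image)
    ultimately have "card E < card (S \<theta>)"
      using many by (auto split: if_splits)
    then obtain \<alpha> where \<alpha>0: "\<exists>v\<in>S \<theta>. \<alpha> v \<noteq> 0"
      and \<alpha>E: "\<forall>e\<in>E. (\<Sum>v\<in>S \<theta>. \<alpha> v * A v e) = 0"
      using underdetermined_system_nontrivial_solution[of E "S \<theta>" A] finS by (auto simp: E_def)
    define u where "u j = (\<Sum>v\<in>S \<theta>. \<alpha> v * real (coord v j))" for j
    have u0: "u j = 0" if "j \<notin> T \<theta>" for j
    proof (cases "j \<in> M \<theta>")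
      case True
      then have "Some j \<in> E" using that by (simp add: E_def)
      then show ?thesis using \<alpha>E by (fastforce simp: u_def A_def)
    next
      case False
      then show ?thesis by (simp add: u_def outside)
    qed
    have sum\<alpha>: "sum \<alpha> (S \<theta>) = 0"
    proof (cases "T \<theta> = {}")
      case True
      have "real r * sum \<alpha> (S \<theta>) = (\<Sum>j\<in>UNIV. u j)"
        unfolding u_def using deg SV by (subst fractional_packing_degree[of _ r]) auto
      also have "\<dots> = 0" using True u0 by simp
      finally show ?thesis using r by simp
    next
      case False
      then have "None \<in> E" by (simp add: E_def)
      then show ?thesis using \<alpha>E by (fastforce simp: A_def)
    qed
    have neg: "\<exists>v\<in>S \<theta>. \<alpha> v < 0"
    proof (rule ccontr)
      assume "\<not> ?thesis"
      then have "\<forall>v\<in>S \<theta>. \<alpha> v = 0"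
        using sum\<alpha> finS by (subst (asm) sum_nonneg_eq_0_iff) (auto simp: not_less)
      then show False using \<alpha>0 by auto
    qed
    \<comment> \<open>Constraints along the ray: weights stay nonnegative, fractional coordinates stay below their
      rounding up.\<close>
    define F where "F = Inl ` S \<theta> \<union> Inr ` T \<theta>"
    define p where "p = case_sum \<theta> (\<lambda>j. of_int \<lceil>w \<theta> j\<rceil> - w \<theta> j)"
    define g where "g = case_sum \<alpha> (\<lambda>j. - u j)"
    have "finite F" using finS by (simp add: F_def)
    moreover have "0 < p k" if "k \<in> F" for k
    proof -
      have "w \<theta> j < of_int \<lceil>w \<theta> j\<rceil>" if "j \<in> T \<theta>" for j
        using that by (metis Ints_of_int T_def le_of_int_ceiling mem_Collect_eq order_le_less)
      moreover have "0 < \<theta> v" if "v \<in> S \<theta>" for v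
        using that nonneg[of v] by (auto simp: S_def)
      ultimately show ?thesis using that by (auto simp: F_def p_def)
    qed
    moreover have "\<exists>k\<in>F. g k < 0" using neg by (force simp: F_def g_def)
    ultimately obtain \<epsilon> where \<epsilon>: "\<epsilon> > 0" "\<forall>k\<in>F. 0 \<le> p k + \<epsilon> * g k" "\<exists>k\<in>F. p k + \<epsilon> * g k = 0"
      using first_constraint_hit[of F p g] by auto
    define \<theta>' where "\<theta>' v = (if v \<in> S \<theta> then \<theta> v + \<epsilon> * \<alpha> v else 0)" for v
    have shift: "(\<Sum>v\<in>V. \<theta>' v * f v) = (\<Sum>v\<in>V. \<theta> v * f v) + \<epsilon> * (\<Sum>v\<in>S \<theta>. \<alpha> v * f v)" for f
    proof -
      have "(\<Sum>v\<in>V. \<theta>' v * f v) = (\<Sum>v\<in>S \<theta>. \<theta>' v * f v)"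
        using fin SV by (intro sum.mono_neutral_right) (auto simp: \<theta>'_def)
      also have "\<dots> = (\<Sum>v\<in>S \<theta>. \<theta> v * f v) + \<epsilon> * (\<Sum>v\<in>S \<theta>. \<alpha> v * f v)"
        by (simp add: \<theta>'_def sum_distrib_left sum.distrib[symmetric] algebra_simps)
      also have "(\<Sum>v\<in>S \<theta>. \<theta> v * f v) = (\<Sum>v\<in>V. \<theta> v * f v)"
        using fin SV by (intro sum.mono_neutral_left) (auto simp: S_def)
      finally show ?thesis .
    qed
    have w': "w \<theta>' j = w \<theta> j + \<epsilon> * u j" for j
      unfolding w_def u_def by (rule shift)
    have w'T: "w \<theta>' j \<le> of_int \<lceil>w \<theta> j\<rceil>" if "j \<in> T \<theta>" for j
    proof -
      have "0 \<le> p (Inr j) + \<epsilon> * g (Inr j)" using \<epsilon>(2) that unfolding F_def by blast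
      then show ?thesis by (simp add: p_def g_def w')
    qed
    have "w \<theta>' j \<le> coord a j" for j
    proof (cases "j \<in> T \<theta>")
      case True
      have "\<lceil>w \<theta> j\<rceil> \<le> int (coord a j)" using le[of j] by (simp add: ceiling_le_iff)
      then show ?thesis using w'T[OF True] by linarith
    next
      case False
      then show ?thesis using le u0 by (simp add: w')
    qed
    moreover have "\<forall>v\<in>V. 0 \<le> \<theta>' v"
    proof -
      have "0 \<le> p (Inl v) + \<epsilon> * g (Inl v)" if "v \<in> S \<theta>" for v
        using \<epsilon>(2) that unfolding F_def by blast
      then show ?thesis by (simp add: \<theta>'_def p_def g_def)
    qed
    moreover have "sum \<theta>' V = c"
      using shift[of "\<lambda>_. 1"] sum\<alpha> sum\<theta> by simp
    ultimately have "fractional_packing V c a \<theta>'"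
      by (simp add: fractional_packing_def w_def)
    then have "card (S \<theta>) + card (T \<theta>) \<le> card (S \<theta>') + card (T \<theta>')" by (rule least)
    moreover have "S \<theta>' \<subseteq> S \<theta>" by (auto simp: S_def \<theta>'_def)
    moreover have "T \<theta>' \<subseteq> T \<theta>" using u0 by (auto simp: T_def w')
    moreover have "S \<theta>' \<noteq> S \<theta> \<or> T \<theta>' \<noteq> T \<theta>"
    proof -
      from \<epsilon>(3) consider v where "v \<in> S \<theta>" "\<theta> v + \<epsilon> * \<alpha> v = 0"
        | j where "j \<in> T \<theta>" "of_int \<lceil>w \<theta> j\<rceil> = w \<theta>' j"
        by (auto simp: F_def p_def g_def w')
      then show ?thesis
      proof cases
        case 1
        then have "v \<notin> S \<theta>'" by (simp add: S_def \<theta>'_def)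
        then show ?thesis using 1 by auto
      next
        case 2
        then have "j \<notin> T \<theta>'" unfolding T_def by (metis Ints_of_int mem_Collect_eq)
        then show ?thesis using 2 by auto
      qed
    qed
    ultimately show False
      using psubset_card_mono[OF finS, of "S \<theta>'"] psubset_card_mono[of "T \<theta>" "T \<theta>'"]
        card_mono[OF finS, of "S \<theta>'"] card_mono[of "T \<theta>" "T \<theta>'"]
      by (auto simp: psubset_eq)
  qed
  then show ?thesis
    using that[OF \<theta>] by (simp add: sparse_def S_def T_def M_def w_def)
qed

text \<open>
  Here the number \<open>d - d div r\<close> arises (\<open>d\<close> is the number of variables). Let \<open>w\<close> be the weighted sum
  and reflect it to \<open>u - w\<close>, where \<open>u\<close> is the sum of the \<open>s\<close> vectors of nonzero weight. Since all weights
  are below one, \<open>u - w\<close> is positive wherever \<open>w\<close> is, so the integer vector \<open>u - \<lfloor>w\<rfloor>\<close> is at least one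
  on the \<open>m\<close> nonzero coordinates of \<open>w\<close>. Comparing degrees gives
  \<open>r s \<ge> \<Sum>\<lfloor>w\<rfloor> + m \<ge> r c - t + \<delta> + m\<close>, where \<open>\<delta>\<close> is \<open>1\<close> if \<open>t > 0\<close> and \<open>0\<close> otherwise: the \<open>t\<close> fractional
  parts add up to an integer less than \<open>t\<close> unless \<open>t = 0\<close>. With \<open>n = m - t + \<delta>\<close>, sparsity says \<open>s \<le> n\<close>,
  hence \<open>r c \<le> (r - 1) n \<le> (r - 1) d\<close>.
\<close>

lemma sparse_packing_sum_bound:
  fixes V :: "('n::finite \<Rightarrow>\<^sub>0 nat) set"
  assumes fin: "finite V" and deg: "\<And>v. v \<in> V \<Longrightarrow> monomial_degree v = r" and r: "r \<ge> 1"
    and c: "sum \<theta> V = real c"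
    and \<theta>: "\<And>v. v \<in> V \<Longrightarrow> 0 \<le> \<theta> v" "\<And>v. v \<in> V \<Longrightarrow> \<theta> v < 1"
    and sparse: "sparse V \<theta>"
  shows "c + CARD('n) div r \<le> CARD('n)"
proof -
  define w where "w j = (\<Sum>v\<in>V. \<theta> v * real (coord v j))" for j
  define S where "S = {v\<in>V. \<theta> v \<noteq> 0}"
  define T where "T = {j. w j \<notin> \<int>}"
  define M where "M = {j. w j \<noteq> 0}"
  define \<delta> where "\<delta> = (if T = {} then 0 else 1 :: nat)"
  have sp: "card S + card T \<le> card M + \<delta>"
    using sparse by (simp add: sparse_def S_def T_def M_def w_def \<delta>_def)
  have TM: "card T \<le> card M" by (intro card_mono) (auto simp: T_def M_def)
  have \<delta>T: "\<delta> \<le> card T" by (auto simp: \<delta>_def Suc_le_eq card_gt_0_iff)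
  have finS: "finite S" using fin by (simp add: S_def)
  have wS: "w j = (\<Sum>v\<in>S. \<theta> v * real (coord v j))" for j
    unfolding w_def using fin by (intro sum.mono_neutral_right) (auto simp: S_def)
  have reflect: "\<lfloor>w j\<rfloor> + 1 \<le> int (\<Sum>v\<in>S. coord v j)" if "j \<in> M" for j
  proof -
    have "\<exists>v\<in>S. coord v j \<noteq> 0"
      using that by (force simp: M_def wS intro: sum.neutral)
    then have "w j < (\<Sum>v\<in>S. real (coord v j))"
      unfolding wS using finS \<theta>
      by (intro sum_strict_mono_ex1) (auto simp: S_def mult_left_le_one_le less_imp_le)
    then show ?thesis by (simp add: floor_less_iff flip: of_nat_sum) linarith
  qed
  have outside: "\<lfloor>w j\<rfloor> = 0" if "j \<notin> M" for j using that by (simp add: M_def)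
  have total: "(\<Sum>j\<in>UNIV. w j) = real (r * c)"
    using fractional_packing_degree[OF deg, of V \<theta>] c by (simp add: w_def)
  have fracsum: "real (r * c) = of_int (\<Sum>j\<in>UNIV. \<lfloor>w j\<rfloor>) + (\<Sum>j\<in>T. frac (w j))"
  proof -
    have "(\<Sum>j\<in>T. frac (w j)) = (\<Sum>j\<in>UNIV. frac (w j))"
      by (intro sum.mono_neutral_left) (auto simp: T_def)
    then show ?thesis
      unfolding total[symmetric] by (simp add: frac_def sum_subtractf)
  qed
  have "int (r * c) + \<delta> \<le> (\<Sum>j\<in>UNIV. \<lfloor>w j\<rfloor>) + card T"
  proof (cases "T = {}")
    case True
    then have "real_of_int (int (r * c)) = real_of_int (\<Sum>j\<in>UNIV. \<lfloor>w j\<rfloor>)"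
      using fracsum by simp
    then have "int (r * c) = (\<Sum>j\<in>UNIV. \<lfloor>w j\<rfloor>)" by (simp only: of_int_eq_iff)
    then show ?thesis using True by (simp add: \<delta>_def)
  next
    case False
    then have "(\<Sum>j\<in>T. frac (w j)) < (\<Sum>j\<in>T. 1)"
      by (intro sum_strict_mono) (auto simp: frac_lt_1)
    then have "real_of_int (int (r * c)) < real_of_int ((\<Sum>j\<in>UNIV. \<lfloor>w j\<rfloor>) + card T)"
      using fracsum by simp
    then have "int (r * c) < (\<Sum>j\<in>UNIV. \<lfloor>w j\<rfloor>) + card T" by (simp only: of_int_less_iff)
    then show ?thesis using False by (simp add: \<delta>_def)
  qed
  moreover have "(\<Sum>j\<in>UNIV. \<lfloor>w j\<rfloor>) + card M \<le> int (r * card S)"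
  proof -
    have "(\<Sum>j\<in>UNIV. \<lfloor>w j\<rfloor>) + card M = (\<Sum>j\<in>M. \<lfloor>w j\<rfloor> + 1)"
      using outside by (simp add: sum.distrib sum.mono_neutral_right[of UNIV M])
    also have "\<dots> \<le> (\<Sum>j\<in>M. int (\<Sum>v\<in>S. coord v j))"
      by (intro sum_mono reflect)
    also have "\<dots> \<le> (\<Sum>j\<in>UNIV. int (\<Sum>v\<in>S. coord v j))"
      by (intro sum_mono2) (auto intro: sum_nonneg)
    also have "\<dots> = int (\<Sum>v\<in>S. \<Sum>j\<in>UNIV. coord v j)"
      by (subst sum.swap) simp
    also have "(\<Sum>v\<in>S. \<Sum>j\<in>UNIV. coord v j) = (\<Sum>v\<in>S. r)"
      using deg by (intro sum.cong) (auto simp: S_def monomial_degree_def)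
    finally show ?thesis by (simp add: mult.commute)
  qed
  ultimately have "r * c + \<delta> + card M \<le> r * card S + card T" by linarith
  moreover define n where "n = card M + \<delta> - card T"
  moreover have "card S \<le> n" using sp by (simp add: n_def)
  then have "r * card S \<le> r * n" by simp
  ultimately have "r * c + n \<le> r * n" using TM by linarith
  moreover have "n \<le> CARD('n)"
    using \<delta>T card_mono[of UNIV M] by (simp add: n_def)
  then have "(r - 1) * n \<le> (r - 1) * CARD('n)" by simp
  then have "r * n - n \<le> r * CARD('n) - CARD('n)" by (simp add: diff_mult_distrib)
  moreover have "n \<le> r * n" "CARD('n) \<le> r * CARD('n)" using r by simp_all
  ultimately have "r * c + CARD('n) \<le> r * CARD('n)"
    by linarith
  moreover have "r * (CARD('n) div r) \<le> CARD('n)" by simp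
  ultimately have "r * (c + CARD('n) div r) \<le> r * CARD('n)"
    unfolding distrib_left by linarith
  then show ?thesis using r by simp
qed

text \<open>
  A sparse packing of total weight \<open>c\<close> must, for \<open>c\<close> this large, have a weight of at least one by the preceding bound;
  lowering that weight by one removes the corresponding vector from \<open>a\<close>.
\<close>

lemma newton_remove_vertex:
  fixes V :: "('n::finite \<Rightarrow>\<^sub>0 nat) set"
  assumes fin: "finite V" and deg: "\<And>v. v \<in> V \<Longrightarrow> monomial_degree v = r" and r: "r \<ge> 1"
    and c: "c \<ge> CARD('n) - CARD('n) div r + 1" and a: "a \<in> newton V (real c)"
  obtains v a' where "v \<in> V" "a' \<in> newton V (real (c - 1))" "a = v + a'"
proof -
  obtain \<theta> where \<theta>: "fractional_packing V (real c) a \<theta>"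
    and sparse: "sparse V \<theta>"
    using sparse_fractional_packing[OF fin deg r a] by blast
  have "\<exists>v\<in>V. 1 \<le> \<theta> v"
  proof (rule ccontr)
    assume "\<not> ?thesis"
    then have "c + CARD('n) div r \<le> CARD('n)"
      using \<theta> sparse by (intro sparse_packing_sum_bound[OF fin deg r]) (auto simp: fractional_packing_def not_le)
    then show False using c by linarith
  qed
  then obtain v where v: "v \<in> V" "1 \<le> \<theta> v" by auto
  define \<mu> where "\<mu> = \<theta>(v := \<theta> v - 1)"
  have shift: "(\<Sum>x\<in>V. \<mu> x * f x) = (\<Sum>x\<in>V. \<theta> x * f x) - f v" for f
    using fin v by (simp add: \<mu>_def sum.remove[of V v] algebra_simps)
  have \<mu>0: "\<forall>x\<in>V. 0 \<le> \<mu> x"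
    using \<theta> v by (auto simp: \<mu>_def fractional_packing_def)
  have ge: "(\<Sum>x\<in>V. \<mu> x * real (coord x j)) \<le> real (coord a j) - real (coord v j)" for j
    using \<theta> by (simp add: shift fractional_packing_def)
  have "coord v j \<le> coord a j" for j
  proof -
    have "0 \<le> (\<Sum>x\<in>V. \<mu> x * real (coord x j))" using \<mu>0 by (intro sum_nonneg) auto
    then show ?thesis using ge[of j] by linarith
  qed
  then have "a = v + (a - v)"
    by (intro poly_mapping_eqI) (simp add: lookup_add lookup_minus)
  moreover have "sum \<mu> V = real (c - 1)"
    using shift[of "\<lambda>_. 1"] \<theta> c by (simp add: fractional_packing_def of_nat_diff)
  then have "fractional_packing V (real (c - 1)) (a - v) \<mu>"
    using \<mu>0 ge \<open>\<And>j. coord v j \<le> coord a j\<close>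
    by (auto simp: fractional_packing_def lookup_minus of_nat_diff)
  then have "a - v \<in> newton V (real (c - 1))" by (auto simp: newton_iff)
  ultimately show ?thesis using that v by blast
qed

section \<open>Supports of integral polynomials\<close>

text \<open>
  The packings into \<open>a\<close>, of whatever total weight, form a compact set, because the total weight is bounded by the degree of \<open>a\<close>.
  Attaining the supremum is what makes the Newton polyhedron recognisable from levels: a vector with level
  at least \<open>c\<close> lies in \<open>newton V c\<close>, also in the boundary case.
\<close>

lemma newton_max_level:
  assumes fin: "finite V" and deg: "\<And>v. v \<in> V \<Longrightarrow> monomial_degree v = r" and r: "r \<ge> 1"
  shows "\<exists>c. a \<in> newton V c \<and> (\<forall>c'. a \<in> newton V c' \<longrightarrow> c' \<le> c)"
proof -
  define D where "D = real (monomial_degree a)"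
  \<comment> \<open>Weights outside \<open>V\<close> are pinned to zero so that the box is compact in the space of all functions.\<close>
  define B where "B v = (if v \<in> V then {0..D} else {0})" for v :: "'a \<Rightarrow>\<^sub>0 nat"
  define K where "K = PiE UNIV B \<inter> {\<theta>. \<forall>j. (\<Sum>v\<in>V. \<theta> v * real (coord v j)) \<le> real (coord a j)}"
  have "compact (PiE UNIV B)"
  proof -
    have "compactin (product_topology (\<lambda>_. euclidean) UNIV) (PiE UNIV B)"
      by (subst compactin_PiE) (auto simp: B_def)
    then show ?thesis by (simp add: euclidean_product_topology)
  qed
  moreover have "closed {\<theta>. \<forall>j. (\<Sum>v\<in>V. \<theta> v * real (coord v j)) \<le> real (coord a j)}"
    by (intro closed_Collect_all closed_Collect_le continuous_intros continuous_on_product_coordinates)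
  ultimately have "compact K" unfolding K_def by (rule compact_Int_closed)
  moreover have "(\<lambda>_. 0) \<in> K" by (auto simp: K_def B_def D_def)
  moreover have "continuous_on K (\<lambda>\<theta>. sum \<theta> V)"
    by (rule continuous_on_subset[of UNIV]) (auto intro!: continuous_intros continuous_on_product_coordinates)
  ultimately obtain \<theta> where \<theta>: "\<theta> \<in> K" "\<And>\<mu>. \<mu> \<in> K \<Longrightarrow> sum \<mu> V \<le> sum \<theta> V"
    using continuous_attains_sup[of K "\<lambda>\<theta>. sum \<theta> V"] by auto
  have "0 \<le> \<theta> v" if "v \<in> V" for v
  proof -
    have "\<theta> v \<in> B v" using \<theta>(1) by (auto simp: K_def)
    then show ?thesis using that by (simp add: B_def)
  qed
  then have "a \<in> newton V (sum \<theta> V)"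
    using \<theta>(1) by (auto simp: newton_iff fractional_packing_def K_def)
  moreover have "c \<le> sum \<theta> V" if ac: "a \<in> newton V c" for c
  proof -
    obtain \<mu> where \<mu>: "fractional_packing V c a \<mu>" using ac unfolding newton_iff by blast
    have "c \<le> real r * c" using r newton_nonneg[OF ac] by (simp add: mult_le_cancel_right1)
    then have "c \<le> D" using newton_degree_bound[OF deg ac] by (simp add: D_def)
    moreover have "\<mu> v \<le> c" if "v \<in> V" for v
      using \<mu> that fin member_le_sum[of v V \<mu>] by (auto simp: fractional_packing_def)
    ultimately have "(\<lambda>v. if v \<in> V then \<mu> v else 0) \<in> K"
      using \<mu> by (force simp: K_def B_def fractional_packing_def)
    then show ?thesis using \<theta>(2) \<mu> by (force simp: fractional_packing_def)
  qed
  ultimately show ?thesis by blast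
qed

text \<open>
  The extremal-exponent principle: a product cannot cancel at an exponent that arises in only one way.
\<close>

lemma lookup_mult_unique_decomposition:
  fixes f g :: "('m, 'c::field) mpoly"
  assumes "\<And>x y. x \<in> Poly_Mapping.keys f \<Longrightarrow> y \<in> Poly_Mapping.keys g \<Longrightarrow> x + y = a + b \<Longrightarrow> x = a"
  shows "Poly_Mapping.lookup (f * g) (a + b) = Poly_Mapping.lookup f a * Poly_Mapping.lookup g b"
proof -
  define f' where "f' = f - Poly_Mapping.single a (Poly_Mapping.lookup f a)"
  define g' where "g' = g - Poly_Mapping.single b (Poly_Mapping.lookup g b)"
  have f: "f = Poly_Mapping.single a (Poly_Mapping.lookup f a) + f'" by (simp add: f'_def)
  have g: "g = Poly_Mapping.single b (Poly_Mapping.lookup g b) + g'" by (simp add: g'_def)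
  have kf: "Poly_Mapping.keys f' \<subseteq> Poly_Mapping.keys f - {a}"
    by (auto simp: f'_def in_keys_iff lookup_minus lookup_single when_def split: if_splits)
  have kg: "Poly_Mapping.keys g' \<subseteq> - {b}"
    by (auto simp: g'_def in_keys_iff lookup_minus lookup_single when_def split: if_splits)
  have "a + b \<notin> Poly_Mapping.keys (f' * g)"
    using keys_mult[of f' g] kf assms by fastforce
  moreover have "a + b \<notin> Poly_Mapping.keys (Poly_Mapping.single a (Poly_Mapping.lookup f a) * g')"
    using keys_mult[of "Poly_Mapping.single a (Poly_Mapping.lookup f a)" g'] kg
    by (auto split: if_splits)
  moreover have "f * g = Poly_Mapping.single a (Poly_Mapping.lookup f a) * Poly_Mapping.single b (Poly_Mapping.lookup g b)
      + Poly_Mapping.single a (Poly_Mapping.lookup f a) * g' + f' * g"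
    using arg_cong[OF f, of "\<lambda>h. h * g"]
      arg_cong[OF g, of "\<lambda>h. Poly_Mapping.single a (Poly_Mapping.lookup f a) * h"]
    by (simp only: distrib_left distrib_right)
  ultimately show ?thesis by (simp add: lookup_add in_keys_iff mult_single)
qed

definition level :: "('n::finite \<Rightarrow>\<^sub>0 nat) set \<Rightarrow> ('n \<Rightarrow>\<^sub>0 nat) \<Rightarrow> real" where
  "level V a = Sup {c. a \<in> newton V c}"

context
  fixes V :: "('n::finite \<Rightarrow>\<^sub>0 nat) set" and r :: nat
  assumes fin: "finite V" and deg: "\<And>v. v \<in> V \<Longrightarrow> monomial_degree v = r" and r: "r \<ge> 1"
begin

lemma newton_level: "a \<in> newton V (level V a)"
  and level_upper: "a \<in> newton V c \<Longrightarrow> c \<le> level V a"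
proof -
  obtain m where m: "a \<in> newton V m" "\<forall>c'. a \<in> newton V c' \<longrightarrow> c' \<le> m"
    using newton_max_level[OF fin deg r] by blast
  have "level V a = m" unfolding level_def using m by (intro cSup_eq_maximum) auto
  then show "a \<in> newton V (level V a)" "a \<in> newton V c \<Longrightarrow> c \<le> level V a" using m by auto
qed

lemma level_superadditive: "level V a + level V a' \<le> level V (a + a')"
  by (intro level_upper newton_add newton_level)

lemma level_nonneg: "0 \<le> level V a"
  using newton_level by (rule newton_nonneg)

lemma level_multiple_le: "level V (\<Sum>i<n. a) \<le> real n * level V a"
proof (cases "n = 0")
  case True
  have "real r * level V 0 \<le> real (monomial_degree (0 :: 'n \<Rightarrow>\<^sub>0 nat))"
    by (rule newton_degree_bound[of V r]) (auto intro: deg newton_level)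
  then show ?thesis using True r level_nonneg[of 0]
    by (simp add: monomial_degree_def mult_le_0_iff)
next
  case False
  then show ?thesis
    using newton_divide[OF newton_level[of "\<Sum>i<n. a"]] level_upper[of a "level V (\<Sum>i<n. a) / real n"]
    by (simp add: field_simps)
qed

text \<open>
  The level is superadditive and homogeneous, so it behaves like a monomial valuation. Let \<open>l\<close> be the
  least level on the support of \<open>f\<close>, attained at \<open>a\<close>, and suppose \<open>l < b\<close>. In degree \<open>n\<close> of the equation
  the terms \<open>c i * f ^ (n - i)\<close> have levels at least \<open>i b + (n - i) l > n l\<close>, so they cannot reach the
  exponent \<open>n a\<close>. The power \<open>f ^ n\<close> does reach it, provided \<open>n a\<close> is a sum of \<open>n\<close> support
  exponents in one way only. Choosing \<open>a\<close> of greatest Euclidean length among the exponents of level \<open>l\<close>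
  ensures this: every summand has level \<open>l\<close>, and if vectors no longer than \<open>a\<close> sum to \<open>n a\<close>, all equal \<open>a\<close>.
\<close>

theorem keys_in_newton_if_integral:
  fixes f :: "('n, 'k::field) mpoly"
  assumes n: "n \<ge> 1" and b: "0 \<le> b"
    and eq: "f ^ n + (\<Sum>i=1..n. c i * f ^ (n - i)) = 0"
    and c: "\<And>i. i \<in> {1..n} \<Longrightarrow> Poly_Mapping.keys (c i) \<subseteq> newton V (real i * b)"
  shows "Poly_Mapping.keys f \<subseteq> newton V b"
proof (rule ccontr)
  assume not_subset: "\<not> ?thesis"
  define l where "l = Min (level V ` Poly_Mapping.keys f)"
  have l_le: "l \<le> level V x" if "x \<in> Poly_Mapping.keys f" for x
    using that by (simp add: l_def)
  have "l < b"
    using not_subset l_le newton_mono[OF newton_level b] by fastforce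
  define dot where "dot x y = (\<Sum>j\<in>UNIV. real (coord x j) * real (coord y j))"
    for x y :: "'n \<Rightarrow>\<^sub>0 nat"
  define F where "F = {x \<in> Poly_Mapping.keys f. level V x = l}"
  have "l \<in> level V ` Poly_Mapping.keys f"
    unfolding l_def using not_subset by (intro Min_in) auto
  then have F: "F \<noteq> {}" "finite F" by (auto simp: F_def)
  then have "Max ((\<lambda>x. dot x x) ` F) \<in> (\<lambda>x. dot x x) ` F" by (intro Max_in) auto
  then obtain a where a: "a \<in> F" and dota: "Max ((\<lambda>x. dot x x) ` F) = dot a a" by auto
  have longest: "dot x x \<le> dot a a" if "x \<in> F" for x
    using that F by (simp flip: dota)
  \<comment> \<open>The Cauchy--Schwarz inequality against \<open>a\<close>, in the form that also settles equality.\<close>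
  have square: "(\<Sum>j\<in>UNIV. (real (coord x j) - real (coord a j))\<^sup>2) = dot x x - 2 * dot x a + dot a a" for x
    by (simp add: dot_def power2_diff power2_eq_square sum.distrib sum_subtractf sum_distrib_left algebra_simps)
  have dot_le: "dot x a \<le> dot a a" if "x \<in> F" for x
  proof -
    have "0 \<le> (\<Sum>j\<in>UNIV. (real (coord x j) - real (coord a j))\<^sup>2)" by (intro sum_nonneg) auto
    then show ?thesis using longest[OF that] unfolding square by linarith
  qed
  have dot_eq: "x = a" if "x \<in> F" "dot x a = dot a a" for x
  proof -
    have "(\<Sum>j\<in>UNIV. (real (coord x j) - real (coord a j))\<^sup>2) \<le> 0"
      using longest[OF that(1)] that(2) unfolding square by linarith
    then have "(\<Sum>j\<in>UNIV. (real (coord x j) - real (coord a j))\<^sup>2) = 0"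
      by (intro antisym sum_nonneg) auto
    then show ?thesis
      by (intro poly_mapping_eqI) (simp add: sum_nonneg_eq_0_iff)
  qed
  have dot_add: "dot (x + y) a = dot x a + dot y a" for x y
    by (simp add: dot_def lookup_add distrib_right sum.distrib)
  \<comment> \<open>The second component records the tie-break: on the least level, \<open>a\<close> maximises \<open>dot _ a\<close>.\<close>
  have keys_power: "real m * l \<le> level V y \<and> (level V y = real m * l \<longrightarrow> dot y a \<le> real m * dot a a)"
    if "y \<in> Poly_Mapping.keys (f ^ m)" for m y
    using that
  proof (induction m arbitrary: y)
    case 0
    then show ?case by (simp add: level_nonneg dot_def)
  next
    case (Suc m)
    obtain x z where xz: "x \<in> Poly_Mapping.keys f" "z \<in> Poly_Mapping.keys (f ^ m)" "y = x + z"
      using Suc.prems keys_mult[of f "f ^ m"] by auto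
    note IH = Suc.IH[OF xz(2)]
    have sup: "level V x + level V z \<le> level V y"
      unfolding xz(3) by (rule level_superadditive)
    have "dot y a \<le> real (Suc m) * dot a a" if "level V y = real (Suc m) * l"
    proof -
      have "level V x + level V z \<le> l + real m * l"
        using sup that by (simp add: distrib_right)
      then have "level V x = l" "level V z = real m * l"
        using l_le[OF xz(1)] IH by linarith+
      then show ?thesis
        using IH dot_le[of x] xz by (simp add: F_def dot_add distrib_right)
    qed
    then show ?case using sup l_le[OF xz(1)] IH by (simp add: distrib_right)
  qed
  have coeff: "Poly_Mapping.lookup (f ^ m) (\<Sum>i<m. a) = Poly_Mapping.lookup f a ^ m" for m
  proof (induction m)
    case 0
    then show ?case by simp
  next
    case (Suc m)
    have "x = a" if x: "x \<in> Poly_Mapping.keys f" and y: "y \<in> Poly_Mapping.keys (f ^ m)"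
      and xy: "x + y = a + (\<Sum>i<m. a)" for x y
    proof -
      have xy': "x + y = (\<Sum>i<Suc m. a)" using xy by (simp add: add.commute)
      have "level V (\<Sum>i<Suc m. a) \<le> real (Suc m) * l"
        using level_multiple_le[of a "Suc m"] a by (simp add: F_def)
      then have "level V x + level V y \<le> l + real m * l"
        using level_superadditive[of x y] by (simp add: xy' distrib_right)
      then have lv: "level V x = l" "level V y = real m * l"
        using l_le[OF x] keys_power[OF y] by linarith+
      have "dot (\<Sum>i<k. a) a = real k * dot a a" for k
        by (simp add: dot_def lookup_sum sum_distrib_left mult.assoc)
      then have "dot x a + dot y a = real (Suc m) * dot a a"
        using dot_add[of x y] xy' by metis
      then have "dot a a \<le> dot x a"
        using keys_power[OF y] lv(2) by (simp add: distrib_right)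
      then show ?thesis using dot_le[of x] dot_eq[of x] x lv(1) by (auto simp: F_def)
    qed
    then have "Poly_Mapping.lookup (f * f ^ m) (a + (\<Sum>i<m. a)) = Poly_Mapping.lookup f a ^ Suc m"
      using Suc.IH by (subst lookup_mult_unique_decomposition) auto
    then show ?case by (simp add: add.commute)
  qed
  have "Poly_Mapping.lookup (c i * f ^ (n - i)) (\<Sum>i<n. a) = 0" if i: "i \<in> {1..n}" for i
  proof (rule ccontr)
    assume "\<not> ?thesis"
    then obtain x y where xy: "x \<in> Poly_Mapping.keys (c i)" "y \<in> Poly_Mapping.keys (f ^ (n - i))"
      "(\<Sum>i<n. a) = x + y"
      using keys_mult[of "c i" "f ^ (n - i)"] by (auto simp flip: in_keys_iff)
    have "real i * b \<le> level V x" using c[OF i] xy(1) level_upper by blast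
    moreover have "real (n - i) * l \<le> level V y" using keys_power[OF xy(2)] by blast
    moreover have "level V x + level V y \<le> real n * l"
      using level_superadditive[of x y] level_multiple_le[of a n] a by (simp add: F_def flip: xy(3))
    moreover have "real (n - i) * l = real n * l - real i * l"
      using i by (simp add: of_nat_diff left_diff_distrib)
    ultimately have "real i * b \<le> real i * l" by linarith
    then show False using i \<open>l < b\<close> by simp
  qed
  then have "Poly_Mapping.lookup (f ^ n + (\<Sum>i=1..n. c i * f ^ (n - i))) (\<Sum>i<n. a)
      = Poly_Mapping.lookup f a ^ n"
    by (simp add: lookup_add lookup_sum coeff)
  then have "Poly_Mapping.lookup f a = 0" using eq n by simp
  then show False using a by (simp add: F_def in_keys_iff)
qed

end

section \<open>Integral dependence by elimination\<close>

text \<open>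
  The values at \<open>x\<close> of the tails \<open>c 1 * X ^ (k - 1) + \<dots> + c k\<close> of integral equations of degree \<open>k\<close>.
  With \<open>x\<close> of degree one and \<open>ideal_power J i\<close> of degree \<open>i\<close> they are homogeneous of degree \<open>k\<close>, and
  degrees add under multiplication; so elimination can keep track of the powers of \<open>J\<close>.
\<close>

definition integral_tails :: "'a::comm_ring_1 set \<Rightarrow> 'a \<Rightarrow> nat \<Rightarrow> 'a set" where
  "integral_tails J x k = {\<Sum>i=1..k. c i * x ^ (k - i) | c. \<forall>i\<in>{1..k}. c i \<in> ideal_power J i}"

interpretation ring_module: module "(*) :: 'a::comm_ring_1 \<Rightarrow> 'a \<Rightarrow> 'a"
  by (rule module_times)

lemma subspace_ideal_mult: "ring_module.subspace (ideal_mult I J)"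
  by (simp add: ideal_mult_def ideal_generated_def)

lemma subspace_ideal_power: "ring_module.subspace (ideal_power J n)"
  by (cases n) (auto simp: subspace_ideal_mult)

lemma mult_in_ideal_mult: "x \<in> I \<Longrightarrow> y \<in> J \<Longrightarrow> x * y \<in> ideal_mult I J"
  by (auto simp: ideal_mult_def ideal_generated_def intro: ring_module.span_base)

lemma mult_in_ideal_power_add:
  assumes "x \<in> ideal_power J m" "y \<in> ideal_power J n"
  shows "x * y \<in> ideal_power J (m + n)"
  using assms
proof (induction m arbitrary: x)
  case 0
  then show ?case using subspace_ideal_power ring_module.subspace_scale by fastforce
next
  case (Suc m)
  have "x \<in> ring_module.span {a * b |a b. a \<in> J \<and> b \<in> ideal_power J m}"
    using Suc.prems by (simp add: ideal_mult_def ideal_generated_def)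
  then show ?case
  proof (induction rule: ring_module.span_induct_alt)
    case base
    then show ?case using subspace_ideal_power[THEN ring_module.subspace_0] by (simp del: ideal_power.simps)
  next
    case (step c z w)
    obtain a b where z: "z = a * b" "a \<in> J" "b \<in> ideal_power J m" using step by auto
    have "a * (b * y) \<in> ideal_power J (Suc m + n)"
      unfolding add_Suc ideal_power.simps
      by (rule mult_in_ideal_mult[OF z(2) Suc.IH[OF z(3) Suc.prems(2)]])
    then have "c * (a * (b * y)) \<in> ideal_power J (Suc m + n)"
      by (rule ring_module.subspace_scale[OF subspace_ideal_power])
    then have "c * (a * (b * y)) + w * y \<in> ideal_power J (Suc m + n)"
      using step.IH by (rule ring_module.subspace_add[OF subspace_ideal_power])
    then show ?case by (simp only: z(1) distrib_right mult.assoc)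
  qed
qed

lemma mem_integral_tails:
  "a \<in> integral_tails J x k \<longleftrightarrow>
    (\<exists>c. (\<forall>i\<in>{1..k}. c i \<in> ideal_power J i) \<and> a = (\<Sum>i=1..k. c i * x ^ (k - i)))"
  by (auto simp: integral_tails_def)

lemma integral_tailsI:
  assumes "1 \<le> i" "i \<le> k" "c \<in> ideal_power J i"
  shows "c * x ^ (k - i) \<in> integral_tails J x k"
proof -
  have "c * x ^ (k - i) = (\<Sum>j=1..k. (if j = i then c else 0) * x ^ (k - j))"
    using assms by (subst sum.remove[of _ i]) auto
  moreover have "(if j = i then c else 0) \<in> ideal_power J j" for j
    using assms(3) ring_module.subspace_0[OF subspace_ideal_power] by auto
  ultimately show ?thesis
    unfolding mem_integral_tails by (intro exI[of _ "\<lambda>j. if j = i then c else 0"]) auto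
qed

lemma integral_tails_zero: "0 \<in> integral_tails J x k"
  unfolding integral_tails_def
  by (auto intro!: exI[of _ "\<lambda>_. 0"] ring_module.subspace_0[OF subspace_ideal_power])

lemma integral_tails_add:
  assumes "a \<in> integral_tails J x k" "b \<in> integral_tails J x k"
  shows "a + b \<in> integral_tails J x k"
proof -
  obtain c d where "\<forall>i\<in>{1..k}. c i \<in> ideal_power J i" "a = (\<Sum>i=1..k. c i * x ^ (k - i))"
      "\<forall>i\<in>{1..k}. d i \<in> ideal_power J i" "b = (\<Sum>i=1..k. d i * x ^ (k - i))"
    using assms by (auto simp: integral_tails_def)
  then have "a + b = (\<Sum>i=1..k. (c i + d i) * x ^ (k - i))"
      "\<forall>i\<in>{1..k}. c i + d i \<in> ideal_power J i"
    by (auto simp: sum.distrib distrib_right intro: ring_module.subspace_add[OF subspace_ideal_power])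
  then show ?thesis unfolding mem_integral_tails by (intro exI[of _ "\<lambda>i. c i + d i"]) simp
qed

lemma integral_tails_sum: "(\<And>i. i \<in> A \<Longrightarrow> f i \<in> integral_tails J x k) \<Longrightarrow> sum f A \<in> integral_tails J x k"
  by (induction A rule: infinite_finite_induct) (auto simp: integral_tails_zero integral_tails_add)

lemma integral_tails_uminus:
  assumes "a \<in> integral_tails J x k"
  shows "- a \<in> integral_tails J x k"
proof -
  obtain c where "\<forall>i\<in>{1..k}. c i \<in> ideal_power J i" "a = (\<Sum>i=1..k. c i * x ^ (k - i))"
    using assms by (auto simp: integral_tails_def)
  then have "- a = (\<Sum>i=1..k. (- c i) * x ^ (k - i))"
      "\<forall>i\<in>{1..k}. - c i \<in> ideal_power J i"
    by (auto simp: sum_negf intro: ring_module.subspace_neg[OF subspace_ideal_power])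
  then show ?thesis unfolding mem_integral_tails by (intro exI[of _ "\<lambda>i. - c i"]) simp
qed

lemma integral_tails_diff: "a \<in> integral_tails J x k \<Longrightarrow> b \<in> integral_tails J x k \<Longrightarrow> a - b \<in> integral_tails J x k"
  using integral_tails_add[of a J x k "- b"] integral_tails_uminus[of b J x k] by simp

lemma integral_tails_mult:
  assumes "a \<in> integral_tails J x k" "b \<in> integral_tails J x l"
  shows "a * b \<in> integral_tails J x (k + l)"
proof -
  obtain c d where c: "\<forall>i\<in>{1..k}. c i \<in> ideal_power J i" "a = (\<Sum>i=1..k. c i * x ^ (k - i))"
      and d: "\<forall>i\<in>{1..l}. d i \<in> ideal_power J i" "b = (\<Sum>i=1..l. d i * x ^ (l - i))"
    using assms by (auto simp: integral_tails_def)
  have "a * b = (\<Sum>i=1..k. \<Sum>j=1..l. (c i * x ^ (k - i)) * (d j * x ^ (l - j)))"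
    by (simp add: c d sum_product)
  moreover have "(c i * x ^ (k - i)) * (d j * x ^ (l - j)) \<in> integral_tails J x (k + l)"
    if "i \<in> {1..k}" "j \<in> {1..l}" for i j
  proof -
    have "(k - i) + (l - j) = k + l - (i + j)" using that by auto
    then have "x ^ (k - i) * x ^ (l - j) = x ^ (k + l - (i + j))" by (simp flip: power_add)
    then have "(c i * x ^ (k - i)) * (d j * x ^ (l - j)) = (c i * d j) * x ^ (k + l - (i + j))"
      by (metis mult.assoc mult.left_commute)
    also have "\<dots> \<in> integral_tails J x (k + l)"
      using that c d by (intro integral_tailsI mult_in_ideal_power_add) auto
    finally show ?thesis .
  qed
  ultimately show ?thesis by (auto intro!: integral_tails_sum)
qed

lemma integral_tails_power_mult:
  assumes "a \<in> integral_tails J x k"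
  shows "x ^ l * a \<in> integral_tails J x (l + k)"
proof -
  obtain c where c: "\<forall>i\<in>{1..k}. c i \<in> ideal_power J i" "a = (\<Sum>i=1..k. c i * x ^ (k - i))"
    using assms by (auto simp: integral_tails_def)
  have "x ^ l * a = (\<Sum>i=1..k. c i * x ^ (l + k - i))"
    unfolding c(2) sum_distrib_left
  proof (intro sum.cong refl)
    fix i assume "i \<in> {1..k}"
    then have "l + k - i = l + (k - i)" by auto
    then show "x ^ l * (c i * x ^ (k - i)) = c i * x ^ (l + k - i)"
      by (simp only: power_add mult.left_commute)
  qed
  then show ?thesis
    using c by (auto intro!: integral_tails_sum integral_tailsI)
qed

lemma integral_closure_iff:
  "x \<in> integral_closure J \<longleftrightarrow> (\<exists>n\<ge>1. \<exists>e\<in>integral_tails J x n. x ^ n + e = 0)"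
proof -
  have "(\<exists>e\<in>integral_tails J x n. Q e) \<longleftrightarrow>
      (\<exists>c. (\<forall>i\<in>{1..n}. c i \<in> ideal_power J i) \<and> Q (\<Sum>i=1..n. c i * x ^ (n - i)))" for Q n
    unfolding Bex_def mem_integral_tails by blast
  then show ?thesis unfolding integral_closure_def by (simp only: mem_Collect_eq)
qed

text \<open>
  A substitute for the determinant trick. The entries of \<open>A\<close> are graded: up to tails, the diagonal is
  \<open>x ^ k\<close> and the rest vanishes. Eliminating one unknown by cross-multiplication keeps this shape with \<open>2 k\<close>
  in place of \<open>k\<close>, and a system with a single unknown is an integral equation for \<open>x\<close> that
  annihilates this unknown.
\<close>

lemma integral_dependence_by_elimination:
  fixes x :: "'a::comm_ring_1" and A :: "'b \<Rightarrow> 'b \<Rightarrow> 'a"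
  assumes "finite G" "G \<noteq> {}" "k \<ge> 1"
    and "\<And>g h. g \<in> G \<Longrightarrow> h \<in> G \<Longrightarrow> A g h - (if g = h then x ^ k else 0) \<in> integral_tails J x k"
    and "\<And>g. g \<in> G \<Longrightarrow> (\<Sum>h\<in>G. A g h * y h) = 0"
  shows "\<exists>g\<in>G. \<exists>n\<ge>1. \<exists>e\<in>integral_tails J x n. (x ^ n + e) * y g = 0"
  using assms
proof (induction G arbitrary: A k rule: finite_ne_induct)
  case (singleton g)
  then have "A g g - x ^ k \<in> integral_tails J x k" "(x ^ k + (A g g - x ^ k)) * y g = 0"
    using singleton.prems(2)[of g g] by auto
  then show ?case
    using singleton.prems(1) by (intro bexI[of _ g] exI[of _ k] conjI bexI[of _ "A g g - x ^ k"]) simp_all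
next
  case (insert p G)
  define a where "a = A p p - x ^ k"
  have a: "a \<in> integral_tails J x k" "A p p = x ^ k + a"
    using insert.prems(2)[of p p] by (auto simp: a_def)
  define B where "B g h = A p p * A g h - A g p * A p h" for g h
  have B: "B g h - (if g = h then x ^ (k + k) else 0) \<in> integral_tails J x (k + k)"
    if g: "g \<in> G" and h: "h \<in> G" for g h
  proof -
    define d where "d = A g h - (if g = h then x ^ k else 0)"
    have d: "d \<in> integral_tails J x k" "A g h = (if g = h then x ^ k else 0) + d"
      using insert.prems(2)[of g h] g h by (auto simp: d_def)
    have "g \<noteq> p" "p \<noteq> h" using g h insert.hyps by auto
    then have off: "A g p \<in> integral_tails J x k" "A p h \<in> integral_tails J x k"
      using insert.prems(2)[of g p] insert.prems(2)[of p h] g h by simp_all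
    have "B g h - (if g = h then x ^ (k + k) else 0)
        = (if g = h then x ^ k * a else 0) + x ^ k * d + a * d - A g p * A p h"
      by (simp add: B_def a(2) d(2) power_add algebra_simps)
    moreover have "(if g = h then x ^ k * a else 0) \<in> integral_tails J x (k + k)"
      using a(1) by (auto simp: integral_tails_zero intro: integral_tails_power_mult)
    ultimately show ?thesis
      using a(1) d(1) off
      by (auto intro!: integral_tails_add integral_tails_diff integral_tails_mult integral_tails_power_mult simp del: if_split)
  qed
  have "(\<Sum>h\<in>G. B g h * y h) = 0" if g: "g \<in> G" for g
  proof -
    have row: "(\<Sum>h\<in>G. A i h * y h) = - (A i p * y p)" if "i \<in> insert p G" for i
      using insert.prems(3)[OF that] insert.hyps by (simp add: eq_neg_iff_add_eq_0 add.commute)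
    have "(\<Sum>h\<in>G. B g h * y h) = A p p * (\<Sum>h\<in>G. A g h * y h) - A g p * (\<Sum>h\<in>G. A p h * y h)"
      by (simp only: B_def left_diff_distrib sum_subtractf sum_distrib_left mult.assoc)
    also have "\<dots> = A p p * - (A g p * y p) - A g p * - (A p p * y p)"
      using g by (simp only: row insertI1 insertI2)
    also have "\<dots> = 0" by (simp only: mult_minus_right mult.left_commute diff_self)
    finally show ?thesis .
  qed
  moreover have "1 \<le> k + k" using insert.prems(1) by simp
  ultimately have "\<exists>g\<in>G. \<exists>n\<ge>1. \<exists>e\<in>integral_tails J x n. (x ^ n + e) * y g = 0"
    using B by (intro insert.IH[of "k + k" B])
  then show ?case by (rule bexE) (rule bexI, assumption, rule insertI2)
qed

section \<open>Integral closures of powers of a monomial ideal\<close>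

definition newton_polys :: "('n::finite \<Rightarrow>\<^sub>0 nat) set \<Rightarrow> real \<Rightarrow> ('n, 'k::field) mpoly set" where
  "newton_polys V c = {f. Poly_Mapping.keys f \<subseteq> newton V c}"

lemma newton_polys_add:
  "f \<in> newton_polys V c \<Longrightarrow> g \<in> newton_polys V c \<Longrightarrow> f + g \<in> newton_polys V c"
  using keys_add[of f g] by (auto simp: newton_polys_def)

lemma newton_polys_mult:
  "f \<in> newton_polys V c \<Longrightarrow> g \<in> newton_polys V c' \<Longrightarrow> f * g \<in> newton_polys V (c + c')"
  using keys_mult[of f g] by (fastforce simp: newton_polys_def intro: newton_add)

lemma newton_polys_zero: "newton_polys V 0 = UNIV"
  by (auto simp: newton_polys_def newton_zero)

lemma subspace_newton_polys: "ring_module.subspace (newton_polys V c)"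
proof (rule ring_module.subspaceI)
  show "0 \<in> newton_polys V c" by (simp add: newton_polys_def)
  show "f + g \<in> newton_polys V c" if "f \<in> newton_polys V c" "g \<in> newton_polys V c" for f g
    using that by (rule newton_polys_add)
  show "h * f \<in> newton_polys V c" if "f \<in> newton_polys V c" for h f
    using newton_polys_mult[of h V 0 f c] that by (simp add: newton_polys_zero)
qed

lemma ideal_mult_subset_newton_polys:
  assumes "I \<subseteq> newton_polys V c" "J \<subseteq> newton_polys V c'"
  shows "ideal_mult I J \<subseteq> newton_polys V (c + c')"
  unfolding ideal_mult_def ideal_generated_def
  using assms by (intro ring_module.span_minimal subspace_newton_polys) (auto intro!: newton_polys_mult)

lemma ideal_power_subset_newton_polys:
  assumes "I \<subseteq> newton_polys V c"
  shows "ideal_power I n \<subseteq> newton_polys V (real n * c)"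
proof (induction n)
  case 0
  then show ?case by (simp add: newton_polys_zero)
next
  case (Suc n)
  then show ?case
    using ideal_mult_subset_newton_polys[OF assms Suc] by (simp add: distrib_right)
qed

lemma monomial_ideal_subset_newton_polys:
  assumes "finite V"
  shows "ideal_generated (monomial ` V) \<subseteq> newton_polys V 1"
  unfolding ideal_generated_def using assms
  by (intro ring_module.span_minimal subspace_newton_polys)
    (auto simp: newton_polys_def monomial_def newton_vertex)

lemma sum_of_terms: "f = (\<Sum>a\<in>Poly_Mapping.keys f. Poly_Mapping.single a (Poly_Mapping.lookup f a))"
  by (rule poly_mapping_eqI) (simp add: lookup_sum lookup_single when_def in_keys_iff)

lemma monomial_mult: "monomial a * monomial b = monomial (a + b)"
  by (simp add: monomial_def mult_single)

lemma mult_monomial_eq_0: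
  fixes f :: "('n::finite, 'k::field) mpoly"
  assumes "f * monomial a = 0"
  shows "f = 0"
proof (rule poly_mapping_eqI)
  fix k
  have "Poly_Mapping.lookup (f * monomial a) (k + a) = Poly_Mapping.lookup f k * Poly_Mapping.lookup (monomial a :: ('n, 'k) mpoly) a"
    by (rule lookup_mult_unique_decomposition) (auto simp: monomial_def)
  moreover have "Poly_Mapping.lookup (monomial a :: ('n, 'k) mpoly) a = 1" by (simp add: monomial_def)
  ultimately show "Poly_Mapping.lookup f k = Poly_Mapping.lookup 0 k"
    by (simp add: assms)
qed

context
  fixes V :: "('n::finite \<Rightarrow>\<^sub>0 nat) set" and r :: nat
  assumes fin: "finite V" and deg: "\<And>v. v \<in> V \<Longrightarrow> monomial_degree v = r" and r: "r \<ge> 1"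
begin

text \<open>
  Above the level given by the number of variables, \<open>newton_remove_vertex\<close> applies at every step.
\<close>

lemma newton_remove_vertices:
  assumes "a \<in> newton V (real (n + m))" "m \<ge> CARD('n)"
  shows "\<exists>u a'. (monomial u :: ('n, 'k::field) mpoly) \<in> ideal_power (ideal_generated (monomial ` V)) n
    \<and> a' \<in> newton V (real m) \<and> a = u + a'"
  using assms(1)
proof (induction n arbitrary: a)
  case 0
  then show ?case by (intro exI[of _ 0] exI[of _ a]) auto
next
  case (Suc n)
  have "CARD('n) - CARD('n) div r + 1 \<le> Suc n + m" using assms(2) by linarith
  then obtain v a1 where v: "v \<in> V" "a1 \<in> newton V (real (Suc n + m - 1))" "a = v + a1"
    using newton_remove_vertex[OF fin deg r _ Suc.prems] by blast
  then obtain u a2 where u: "(monomial u :: ('n, 'k) mpoly) \<in> ideal_power (ideal_generated (monomial ` V)) n"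
      "a2 \<in> newton V (real m)" "a1 = u + a2"
    using Suc.IH[of a1] by auto
  have "(monomial v :: ('n, 'k) mpoly) \<in> ideal_generated (monomial ` V)"
    using v(1) by (auto simp: ideal_generated_def intro: ring_module.span_base)
  then have "(monomial v * monomial u :: ('n, 'k) mpoly) \<in> ideal_power (ideal_generated (monomial ` V)) (Suc n)"
    using u(1) by (simp add: mult_in_ideal_mult)
  then show ?case
    using u v by (intro exI[of _ "v + u"] exI[of _ a2]) (simp add: monomial_mult add.assoc)
qed

text \<open>
  Rounding up a weighted sum \<open>w\<close> of total weight \<open>c\<close> gives a vector of \<open>newton V c\<close> below every integral vector
  that dominates \<open>w\<close>, and its coordinates are bounded by the degree \<open>r c\<close> of \<open>w\<close>.
\<close>

lemma newton_finitely_generated: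
  "\<exists>G. finite G \<and> G \<subseteq> newton V c \<and> (\<forall>a\<in>newton V c. \<exists>g\<in>G. \<exists>u. a = u + g)"
proof -
  define N where "N = nat \<lceil>real r * c\<rceil>"
  define G where "G = {a \<in> newton V c. \<forall>j. coord a j \<le> N}"
  have "finite G"
  proof (rule finite_imageD)
    have "coord ` G \<subseteq> PiE UNIV (\<lambda>_. {..N})" by (auto simp: G_def)
    then show "finite (coord ` G)" by (rule finite_subset) (auto intro: finite_PiE)
    show "inj_on coord G" by (auto intro!: inj_onI poly_mapping_eqI)
  qed
  moreover have "\<exists>g\<in>G. \<exists>u. a = u + g" if "a \<in> newton V c" for a
  proof -
    obtain \<theta> where \<theta>: "fractional_packing V c a \<theta>" using \<open>a \<in> newton V c\<close> by (auto simp: newton_iff)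
    define w where "w j = (\<Sum>v\<in>V. \<theta> v * real (coord v j))" for j
    have w0: "0 \<le> w j" for j using \<theta> by (auto simp: w_def fractional_packing_def intro: sum_nonneg)
    have wa: "w j \<le> coord a j" for j using \<theta> by (simp add: w_def fractional_packing_def)
    define g where "g = Abs_poly_mapping (\<lambda>j. nat \<lceil>w j\<rceil>)"
    have g: "coord g j = nat \<lceil>w j\<rceil>" for j by (simp add: g_def)
    have "fractional_packing V c g \<theta>"
      using \<theta> w0 by (simp add: fractional_packing_def g flip: w_def)
    then have "g \<in> newton V c" by (auto simp: newton_iff)
    moreover have "coord g j \<le> N" for j
    proof -
      have "w j \<le> (\<Sum>j\<in>UNIV. w j)" using w0 by (intro member_le_sum) auto
      also have "\<dots> = real r * c"
        using fractional_packing_degree[of V r \<theta>] deg \<theta> by (simp add: w_def fractional_packing_def)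
      finally show ?thesis unfolding g N_def by (intro nat_mono ceiling_mono)
    qed
    moreover have "coord g j \<le> coord a j" for j using wa[of j] by (simp add: g ceiling_le_iff)
    then have "a = (a - g) + g"
      by (intro poly_mapping_eqI) (simp add: lookup_add lookup_minus)
    ultimately show ?thesis unfolding G_def by blast
  qed
  ultimately show ?thesis by (intro exI[of _ G]) (auto simp: G_def)
qed

text \<open>
  Multiplication by \<open>f\<close> raises the level by \<open>b\<close>. Far out, at level \<open>m = d b\<close> with \<open>d\<close> the number of variables,
  a further \<open>b\<close> levels can be split off as a product of \<open>b\<close> generators (\<open>newton_remove_vertices\<close>). Hence the finitely
  generated module of polynomials of level \<open>m\<close> satisfies \<open>f M \<subseteq> I^b M\<close>, which makes \<open>f\<close> integral over
  \<open>I^b\<close> by elimination, since a monomial is not a zero divisor.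
\<close>

lemma newton_polys_subset_integral_closure:
  "(newton_polys V (real b) :: ('n, 'k::field) mpoly set)
    \<subseteq> integral_closure (ideal_power (ideal_generated (monomial ` V)) b)"
proof
  fix f :: "('n, 'k) mpoly"
  assume f: "f \<in> newton_polys V (real b)"
  define J where "J = ideal_power (ideal_generated (monomial ` V :: ('n, 'k) mpoly set)) b"
  define m where "m = CARD('n) * b"
  show "f \<in> integral_closure (ideal_power (ideal_generated (monomial ` V)) b)"
  \<comment> \<open>Only a nonzero \<open>f\<close> provides an exponent, and with it a nonempty set of generators \<open>G\<close> below.\<close>
  proof (cases "f = 0")
    case True
    then show ?thesis
      unfolding integral_closure_iff by (intro exI[of _ 1] conjI bexI[of _ 0] integral_tails_zero) auto
  next
    case False
    then obtain a where "a \<in> Poly_Mapping.keys f" by (metis all_not_in_conv keys_eq_empty)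
    then have a: "a \<in> newton V (real b)" using f by (auto simp: newton_polys_def)
    obtain G where G: "finite G" "G \<subseteq> newton V (real m)"
        "\<forall>a\<in>newton V (real m). \<exists>g\<in>G. \<exists>u. a = u + g"
      using newton_finitely_generated[of "real m"] by (elim exE conjE)
    have "(\<Sum>i<n. a) \<in> newton V (real n * real b)" for n
    proof (induction n)
      case (Suc n)
      then show ?case using newton_add[OF Suc a] by (simp add: distrib_right add.commute)
    qed (simp add: newton_zero)
    then have "(\<Sum>i<CARD('n). a) \<in> newton V (real m)" by (simp add: m_def)
    then have "\<exists>g\<in>G. \<exists>u. (\<Sum>i<CARD('n). a) = u + g" by (rule bspec[OF G(3)])
    then have "G \<noteq> {}" by blast
    \<comment> \<open>The coefficients must lie in \<open>J\<close> itself: then the relations for the multiples of \<open>f\<close> have degree one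
      in the grading of \<open>integral_tails\<close>.\<close>
    have spanned: "\<exists>C. (\<forall>g\<in>G. C g \<in> J) \<and> h = (\<Sum>g\<in>G. C g * monomial g)"
      if "h \<in> newton_polys V (real (b + m))" for h :: "('n, 'k) mpoly"
    proof -
      define Q where "Q = {h. \<exists>C. (\<forall>g\<in>G. C g \<in> J) \<and> h = (\<Sum>g\<in>G. C g * monomial g)}"
      have J: "ring_module.subspace J" by (simp add: J_def subspace_ideal_power)
      have Q0: "0 \<in> Q" unfolding Q_def
        using ring_module.subspace_0[OF J] by (auto intro!: exI[of _ "\<lambda>_. 0"])
      have Qadd: "h1 + h2 \<in> Q" if "h1 \<in> Q" "h2 \<in> Q" for h1 h2
      proof -
        obtain C D where "\<forall>g\<in>G. C g \<in> J" "h1 = (\<Sum>g\<in>G. C g * monomial g)"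
          "\<forall>g\<in>G. D g \<in> J" "h2 = (\<Sum>g\<in>G. D g * monomial g)"
          using \<open>h1 \<in> Q\<close> \<open>h2 \<in> Q\<close> unfolding Q_def by blast
        then show ?thesis unfolding Q_def
          by (auto simp: sum.distrib distrib_right ring_module.subspace_add[OF J] intro!: exI[of _ "\<lambda>g. C g + D g"])
      qed
      have Qsum: "sum t A \<in> Q" if "\<And>x. x \<in> A \<Longrightarrow> t x \<in> Q" for A and t :: "('n \<Rightarrow>\<^sub>0 nat) \<Rightarrow> ('n, 'k) mpoly"
        using that by (induction A rule: infinite_finite_induct) (auto simp: Q0 Qadd)
      have Qsingle: "Poly_Mapping.single x k \<in> Q" if x: "x \<in> newton V (real (b + m))" for x and k :: 'k
      \<comment> \<open>For \<open>b = 0\<close> the ideal power is the whole ring and \<open>m = 0\<close>, so no generator can or need be split off.\<close>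
      proof (cases "b = 0")
        case True
        then obtain g u where g: "g \<in> G" "x = u + g"
          using bspec[OF G(3), of x] x by auto
        show ?thesis unfolding Q_def
          using g G(1) True
          by (auto simp: J_def monomial_def mult_single if_distrib[of "\<lambda>x. x * _"] cong: if_cong
              intro!: exI[of _ "\<lambda>h. if h = g then Poly_Mapping.single u k else 0"])
      next
        case False
        then have "CARD('n) \<le> m" by (simp add: m_def)
        then obtain u x' where u: "(monomial u :: ('n, 'k) mpoly) \<in> J" "x' \<in> newton V (real m)" "x = u + x'"
          using newton_remove_vertices[OF x] unfolding J_def by blast
        then obtain g z where g: "g \<in> G" "x' = z + g" using bspec[OF G(3) u(2)] by blast
        have "Poly_Mapping.single z k * monomial u \<in> J"
          using u(1) by (rule ring_module.subspace_scale[OF J])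
        moreover have "Poly_Mapping.single x k = (Poly_Mapping.single z k * monomial u) * monomial g"
          by (simp add: monomial_def mult_single u g add_ac)
        moreover have "0 \<in> J" by (rule ring_module.subspace_0[OF J])
        ultimately show ?thesis unfolding Q_def
          using g(1) G(1)
          by (auto simp: if_distrib[of "\<lambda>x. x * _"] cong: if_cong
              intro!: exI[of _ "\<lambda>h. if h = g then Poly_Mapping.single z k * monomial u else 0"])
      qed
      have "h \<in> Q"
        using that by (subst sum_of_terms) (auto intro!: Qsum Qsingle simp: newton_polys_def)
      then show ?thesis by (simp add: Q_def)
    qed
    have "\<forall>g\<in>G. \<exists>C. (\<forall>h\<in>G. C h \<in> J) \<and> f * monomial g = (\<Sum>h\<in>G. C h * monomial h)"
    proof
      fix g assume "g \<in> G"
      then have "(monomial g :: ('n, 'k) mpoly) \<in> newton_polys V (real m)"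
        using G(2) by (auto simp: newton_polys_def monomial_def)
      then have "f * monomial g \<in> newton_polys V (real b + real m)"
        by (rule newton_polys_mult[OF f])
      then show "\<exists>C. (\<forall>h\<in>G. C h \<in> J) \<and> f * monomial g = (\<Sum>h\<in>G. C h * monomial h)"
        by (intro spanned) simp
    qed
    then obtain C where C: "\<forall>g\<in>G. (\<forall>h\<in>G. C g h \<in> J) \<and> f * monomial g = (\<Sum>h\<in>G. C g h * monomial h)"
      by (rule bchoice[THEN exE])
    \<comment> \<open>The matrix \<open>f - C\<close> annihilates the vector of the generating monomials.\<close>
    define A where "A g h = (if g = h then f else 0) - C g h" for g h
    have CJ: "C g h \<in> integral_tails J f 1" if "g \<in> G" "h \<in> G" for g h
    proof -
      have "C g h * 1 \<in> ideal_mult J UNIV"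
        using C that by (intro mult_in_ideal_mult) auto
      then have "C g h \<in> ideal_power J 1" by simp
      then have "C g h * f ^ (1 - 1) \<in> integral_tails J f 1"
        by (intro integral_tailsI) auto
      then show ?thesis by simp
    qed
    have "\<exists>g\<in>G. \<exists>n\<ge>1. \<exists>e\<in>integral_tails J f n. (f ^ n + e) * monomial g = 0"
    proof (rule integral_dependence_by_elimination[OF G(1) \<open>G \<noteq> {}\<close>, of 1 A])
      show "A g h - (if g = h then f ^ 1 else 0) \<in> integral_tails J f 1" if "g \<in> G" "h \<in> G" for g h
        using integral_tails_uminus[OF CJ[OF that]] by (cases "g = h") (simp_all add: A_def)
      show "(\<Sum>h\<in>G. A g h * monomial h) = 0" if "g \<in> G" for g
      proof -
        have "(\<Sum>h\<in>G. (if g = h then f else 0) * monomial h) = f * monomial g"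
          using that G(1) by (subst sum.remove[of _ g]) (auto intro!: sum.neutral split: if_splits)
        then have "(\<Sum>h\<in>G. A g h * monomial h) = f * monomial g - (\<Sum>h\<in>G. C g h * monomial h)"
          by (simp only: A_def left_diff_distrib sum_subtractf)
        also have "f * monomial g = (\<Sum>h\<in>G. C g h * monomial h)"
          using bspec[OF C that] by (rule conjunct2)
        finally show ?thesis by (simp only: diff_self)
      qed
    qed simp
    then obtain g n e where ne: "n \<ge> 1" "e \<in> integral_tails J f n"
        and zero: "(f ^ n + e) * monomial g = 0"
      by (elim bexE exE conjE)
    have "f ^ n + e = 0" using zero by (rule mult_monomial_eq_0)
    then show ?thesis
      unfolding integral_closure_iff J_def[symmetric] using ne by (intro exI[of _ n] conjI bexI[of _ e])
  qed
qed

text \<open>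
  One inclusion bounds supports (\<open>keys_in_newton_if_integral\<close>), the other constructs an integral equation
  (\<open>newton_polys_subset_integral_closure\<close>).
\<close>

theorem integral_closure_monomial_ideal_power:
  "integral_closure (ideal_power (ideal_generated (monomial ` V :: ('n, 'k::field) mpoly set)) b)
    = newton_polys V (real b)"
proof
  define J where "J = ideal_power (ideal_generated (monomial ` V :: ('n, 'k) mpoly set)) b"
  have J: "J \<subseteq> newton_polys V (real b)"
    using ideal_power_subset_newton_polys[OF monomial_ideal_subset_newton_polys[OF fin], of b]
    by (simp add: J_def)
  have "integral_closure J \<subseteq> newton_polys V (real b)"
  proof
    fix f assume "f \<in> integral_closure J"
    then obtain n c where n: "n \<ge> 1" "\<forall>i\<in>{1..n}. c i \<in> ideal_power J i"
        "f ^ n + (\<Sum>i=1..n. c i * f ^ (n - i)) = 0"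
      unfolding integral_closure_def by blast
    have "Poly_Mapping.keys f \<subseteq> newton V (real b)"
    proof (rule keys_in_newton_if_integral[OF fin deg r n(1) _ n(3)])
      show "Poly_Mapping.keys (c i) \<subseteq> newton V (real i * real b)" if "i \<in> {1..n}" for i
        using subsetD[OF ideal_power_subset_newton_polys[OF J] bspec[OF n(2) that]]
        by (simp add: newton_polys_def)
    qed auto
    then show "f \<in> newton_polys V (real b)" by (simp add: newton_polys_def)
  qed
  then show "integral_closure (ideal_power (ideal_generated (monomial ` V :: ('n, 'k) mpoly set)) b)
      \<subseteq> newton_polys V (real b)"
    by (simp add: J_def)
qed (rule newton_polys_subset_integral_closure)

text \<open>
  Both sides are spanned by monomials, so \<open>newton_remove_vertex\<close> decides the matter term by term.
\<close>

lemma newton_polys_step: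
  assumes "b \<ge> CARD('n) - CARD('n) div r + 1"
  shows "(newton_polys V (real b) :: ('n, 'k::field) mpoly set)
    = ideal_mult (ideal_generated (monomial ` V)) (newton_polys V (real (b - 1)))"
proof
  have "b \<ge> 1" using assms by (rule order_trans[rotated]) (rule le_add2)
  then have b: "real b = 1 + real (b - 1)" by (simp add: of_nat_diff)
  show "ideal_mult (ideal_generated (monomial ` V)) (newton_polys V (real (b - 1)))
      \<subseteq> (newton_polys V (real b) :: ('n, 'k) mpoly set)"
    by (subst b) (rule ideal_mult_subset_newton_polys[OF monomial_ideal_subset_newton_polys[OF fin] order_refl])
next
  show "(newton_polys V (real b) :: ('n, 'k) mpoly set)
      \<subseteq> ideal_mult (ideal_generated (monomial ` V)) (newton_polys V (real (b - 1)))"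
  proof
    fix f :: "('n, 'k) mpoly"
    assume f: "f \<in> newton_polys V (real b)"
    have "Poly_Mapping.single a k \<in> ideal_mult (ideal_generated (monomial ` V)) (newton_polys V (real (b - 1)))"
      if "a \<in> newton V (real b)" for a and k :: 'k
    proof -
      obtain v a' where v: "v \<in> V" "a' \<in> newton V (real (b - 1))" "a = v + a'"
        using newton_remove_vertex[OF fin deg r assms \<open>a \<in> newton V (real b)\<close>] by blast
      then have "(monomial v :: ('n, 'k) mpoly) \<in> ideal_generated (monomial ` V)"
          "Poly_Mapping.single a' k \<in> newton_polys V (real (b - 1))"
        by (auto simp: ideal_generated_def newton_polys_def intro: ring_module.span_base)
      then have "monomial v * Poly_Mapping.single a' k
          \<in> ideal_mult (ideal_generated (monomial ` V)) (newton_polys V (real (b - 1)))"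
        by (rule mult_in_ideal_mult)
      then show ?thesis by (simp add: v monomial_def mult_single)
    qed
    then show "f \<in> ideal_mult (ideal_generated (monomial ` V)) (newton_polys V (real (b - 1)))"
      using f by (subst sum_of_terms)
        (auto simp: newton_polys_def intro!: ring_module.subspace_sum[OF subspace_ideal_mult])
  qed
qed

end

theorem corollary2p7:
  fixes I :: "('n::finite, 'k::field) mpoly set"
    and v :: "nat \<Rightarrow> 'n \<Rightarrow>\<^sub>0 nat"
    and q r b :: nat
  assumes "r \<ge> 2"
    and "minimally_generated_by I {1..q} (\<lambda>i. monomial (v i))"
    and "\<forall>i\<in>{1..q}. monomial_degree (v i) = r"
    and "b \<ge> CARD('n) - CARD('n) div r + 1"
  shows "integral_closure (ideal_power I b) = ideal_mult I (integral_closure (ideal_power I (b - 1)))"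
proof -
  define V where "V = v ` {1..q}"
  have V: "finite V" "\<And>x. x \<in> V \<Longrightarrow> monomial_degree x = r" and r: "r \<ge> 1"
    using assms(1,3) by (auto simp: V_def)
  have I: "I = ideal_generated (monomial ` V)"
    using assms(2) by (simp add: minimally_generated_by_def V_def image_image)
  show ?thesis
    unfolding I
    by (simp only: integral_closure_monomial_ideal_power[OF V r] newton_polys_step[OF V r assms(4)])
qed

end
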